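(* Let $G$ be a topological group, $\mathcal A$ a d-closed $G$-algebra of subsets of $G$ all having the strong Baire property, $\mathbb A=\varrho[\mathcal A]\le\mathbb{RO}$, and $v\in\mathfrak U$. (i) If $\mathbb B\le\mathbb A$ is a maximal generic $G$-subalgebra, then $\mathcal B\cong_v\mathbb B$ for some tidy maximal generic $G$-subalgebra $\mathcal B\le\mathcal A$. (ii) If $\mathcal B\le\mathcal A$ is a tidy maximal generic $G$-subalgebra, then $\mathcal B\cong_u\mathbb B$ for some $u\in\mathfrak U$ and some maximal generic $G$-subalgebra $\mathbb B\le\mathbb A$. (iii) If $\mathcal B_0\le\mathcal A$ is a maximal generic $G$-subalgebra, then there exist a maximal generic $G$-subalgebra $\mathbb B\le\mathbb A$, a tidy maximal generic $G$-subalgebra $\mathcal B\le\mathcal A$ and an isomorphism $\varphi:\mathcal B_0\to\mathcal B$ such that $\mathcal B\cong_v\mathbb B$ and $\varphi(B)\triangle B$ is nowhere dense for every $B\in\mathcal B_0$.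
   Context: $\mathrm{SBP}$ is the $G$-algebra (under union, complement, left translation) of subsets $A\subseteq G$ with $\mathrm{int}(A)\cup\mathrm{int}(G\setminus A)$ dense. A $G$-algebra of subsets of $G$ is d-closed if $d_q(A)=\{h:h^{-1}A\in q\}$ lies in it for all members $A$ and all ultrafilters $q$ on $\mathcal P(G)$. $\mathbb{RO}$ is the set of regular open subsets of $G$ with the $G$-algebra structure $U\vee V=\mathrm{int}\,\mathrm{cl}(U\cup V)$, $U\wedge V=U\cap V$, $U^\perp=\mathrm{int}(G\setminus U)$, $G$ acting by left translation; $\varrho:\mathrm{SBP}\to\mathbb{RO}$, $\varrho(A)=\mathrm{int}\,\mathrm{cl}(A)$, is a $G$-algebra epimorphism. For a $G$-algebra (Boolean algebra with $G$ acting by automorphisms) an element $A$ is generic if $1=g_1A\vee\dots\vee g_nA$ for some $g_i\in G$; the algebra is generic if every non-zero element is generic; a maximal generic $G$-subalgebra is a generic $G$-subalgebra not properly contained in another generic $G$-subalgebra of the ambient algebra. For an ultrafilter $q$ of $\mathbb{RO}$ and $V\in\mathbb{RO}$, $d_q(V)=\{h\in G:h^{-1}V\in q\}$. $\mathfrak U$ is the set of ultrafilters $v$ of $\mathbb{RO}$ containing every $V\in\mathbb{RO}$ with $e\in V$. A set $A\subseteq G$ is tidy if $V\subseteq A\subseteq\mathrm{cl}(V)$ for some regular open $V$; a family is tidy if all its members are. For $\mathcal B\le\mathrm{SBP}$, $\mathbb B\le\mathbb{RO}$ and an ultrafilter $q$ of $\mathbb{RO}$, $\mathcal B\cong_q\mathbb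 B$ means that $\varrho$ maps $\mathcal B$ into $\mathbb B$, $d_q$ maps $\mathbb B$ into $\mathcal B$, and these restrictions are mutually inverse $G$-algebra isomorphisms. *)

theory Defs
  imports "HOL-Analysis.Analysis"
begin

text \<open>
  The topological group is a type of class \<^class>\<open>topological_group_add\<close>. Despite the additive
  notation this class assumes neither commutativity nor any separation axiom: the product
  \<open>g h\<close> is written \<open>g + h\<close>, the inverse \<open>- g\<close>, the unit \<open>0\<close>, and the left translate
  \<open>g A\<close> is \<open>(+) g ` A\<close>.
\<close>


section \<open>G-algebras\<close>

record ('g, 'b) galg =
  carr :: "'b set"
  join :: "'b \<Rightarrow> 'b \<Rightarrow> 'b"
  meet :: "'b \<Rightarrow> 'b \<Rightarrow> 'b"
  cmpl :: "'b \<Rightarrow> 'b"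
  bott :: "'b"
  topp :: "'b"
  act :: "'g \<Rightarrow> 'b \<Rightarrow> 'b"

locale g_algebra =
  fixes M :: "('g::group_add, 'b) galg"
  assumes join_closed: "\<lbrakk>a \<in> carr M; b \<in> carr M\<rbrakk> \<Longrightarrow> join M a b \<in> carr M"
    and meet_closed: "\<lbrakk>a \<in> carr M; b \<in> carr M\<rbrakk> \<Longrightarrow> meet M a b \<in> carr M"
    and comp_closed: "a \<in> carr M \<Longrightarrow> cmpl M a \<in> carr M"
    and bott_closed: "bott M \<in> carr M"
    and topp_closed: "topp M \<in> carr M"
    and join_comm: "\<lbrakk>a \<in> carr M; b \<in> carr M\<rbrakk> \<Longrightarrow> join M a b = join M b a"
    and meet_comm: "\<lbrakk>a \<in> carr M; b \<in> carr M\<rbrakk> \<Longrightarrow> meet M a b = meet M b a"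
    and join_meet_distrib: "\<lbrakk>a \<in> carr M; b \<in> carr M; c \<in> carr M\<rbrakk> \<Longrightarrow>
          join M a (meet M b c) = meet M (join M a b) (join M a c)"
    and meet_join_distrib: "\<lbrakk>a \<in> carr M; b \<in> carr M; c \<in> carr M\<rbrakk> \<Longrightarrow>
          meet M a (join M b c) = join M (meet M a b) (meet M a c)"
    and join_bott: "a \<in> carr M \<Longrightarrow> join M a (bott M) = a"
    and meet_topp: "a \<in> carr M \<Longrightarrow> meet M a (topp M) = a"
    and join_comp: "a \<in> carr M \<Longrightarrow> join M a (cmpl M a) = topp M"
    and meet_comp: "a \<in> carr M \<Longrightarrow> meet M a (cmpl M a) = bott M"
    and act_closed: "a \<in> carr M \<Longrightarrow> act M g a \<in> carr M"
    and act_zero: "a \<in> carr M \<Longrightarrow> act M 0 a = a"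
    and act_add: "a \<in> carr M \<Longrightarrow> act M (g + h) a = act M g (act M h a)"
    and act_join: "\<lbrakk>a \<in> carr M; b \<in> carr M\<rbrakk> \<Longrightarrow>
          act M g (join M a b) = join M (act M g a) (act M g b)"
    and act_meet: "\<lbrakk>a \<in> carr M; b \<in> carr M\<rbrakk> \<Longrightarrow>
          act M g (meet M a b) = meet M (act M g a) (act M g b)"
    and act_comp: "a \<in> carr M \<Longrightarrow> act M g (cmpl M a) = cmpl M (act M g a)"

text \<open>
  A subalgebra is given by its carrier \<open>S\<close>; as a G-algebra in its own right it is
  \<open>M\<lparr>carr := S\<rparr>\<close>, with the operations inherited from \<open>M\<close>.
\<close>

definition g_subalgebra :: "'b set \<Rightarrow> ('g, 'b) galg \<Rightarrow> bool" where
  "g_subalgebra S M \<longleftrightarrow>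
     S \<subseteq> carr M \<and> bott M \<in> S \<and> topp M \<in> S \<and>
     (\<forall>a\<in>S. \<forall>b\<in>S. join M a b \<in> S \<and> meet M a b \<in> S) \<and>
     (\<forall>a\<in>S. cmpl M a \<in> S) \<and>
     (\<forall>g. \<forall>a\<in>S. act M g a \<in> S)"

definition g_iso :: "('g, 'b) galg \<Rightarrow> ('g, 'c) galg \<Rightarrow> ('b \<Rightarrow> 'c) set" where
  "g_iso M N = {f. bij_betw f (carr M) (carr N) \<and>
     f (bott M) = bott N \<and> f (topp M) = topp N \<and>
     (\<forall>a\<in>carr M. \<forall>b\<in>carr M. f (join M a b) = join N (f a) (f b) \<and>
                            f (meet M a b) = meet N (f a) (f b)) \<and>
     (\<forall>a\<in>carr M. f (cmpl M a) = cmpl N (f a)) \<and>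
     (\<forall>g. \<forall>a\<in>carr M. f (act M g a) = act N g (f a))}"

text \<open>
  The list \<open>gs\<close> enumerates \<open>g\<^sub>1, \<dots>, g\<^sub>n\<close>; the fold is the join of the translates of \<open>a\<close>.
\<close>

definition generic_elem :: "('g, 'b) galg \<Rightarrow> 'b \<Rightarrow> bool" where
  "generic_elem M a \<longleftrightarrow>
     (\<exists>gs. gs \<noteq> [] \<and> topp M = foldr (\<lambda>g b. join M (act M g a) b) gs (bott M))"

definition generic_alg :: "('g, 'b) galg \<Rightarrow> bool" where
  "generic_alg M \<longleftrightarrow> (\<forall>a\<in>carr M. a \<noteq> bott M \<longrightarrow> generic_elem M a)"

definition generic_subalgebra :: "'b set \<Rightarrow> ('g, 'b) galg \<Rightarrow> bool" where
  "generic_subalgebra S M \<longleftrightarrow> g_subalgebra S M \<and> generic_alg (M\<lparr>carr := S\<rparr>)"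

definition maximal_generic_subalgebra :: "'b set \<Rightarrow> ('g, 'b) galg \<Rightarrow> bool" where
  "maximal_generic_subalgebra S M \<longleftrightarrow>
     generic_subalgebra S M \<and> \<not> (\<exists>T. generic_subalgebra T M \<and> S \<subset> T)"

definition ultrafilter :: "'b set \<Rightarrow> ('g, 'b) galg \<Rightarrow> bool" where
  "ultrafilter q M \<longleftrightarrow>
     q \<subseteq> carr M \<and> topp M \<in> q \<and> bott M \<notin> q \<and>
     (\<forall>a\<in>q. \<forall>b\<in>q. meet M a b \<in> q) \<and>
     (\<forall>a\<in>q. \<forall>b\<in>carr M. meet M a b = a \<longrightarrow> b \<in> q) \<and>
     (\<forall>a\<in>carr M. a \<in> q \<or> cmpl M a \<in> q)"


section \<open>Subsets of a group, regular open sets\<close>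

definition powerset_alg :: "('a::group_add, 'a set) galg" where
  "powerset_alg = \<lparr>carr = UNIV, join = (\<union>), meet = (\<inter>), cmpl = uminus,
     bott = {}, topp = UNIV, act = (\<lambda>g A. (+) g ` A)\<rparr>"

definition regular_open :: "'a::topological_space set \<Rightarrow> bool" where
  "regular_open U \<longleftrightarrow> interior (closure U) = U"

definition RO_alg :: "('a::topological_group_add, 'a set) galg" where
  "RO_alg = \<lparr>carr = {U. regular_open U}, join = (\<lambda>U V. interior (closure (U \<union> V))),
     meet = (\<inter>), cmpl = (\<lambda>U. interior (- U)),
     bott = {}, topp = UNIV, act = (\<lambda>g A. (+) g ` A)\<rparr>"

definition SBP :: "'a::topological_space set set" where
  "SBP = {A. closure (interior A \<union> interior (- A)) = UNIV}"

definition rho :: "'a::topological_space set \<Rightarrow> 'a set" where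
  "rho A = interior (closure A)"

text \<open>
  \<open>d\<^sub>q(A) = {h. h\<^sup>-\<^sup>1 A \<in> q}\<close>, used both for ultrafilters of the power set and for ultrafilters of
  the algebra of regular open sets.
\<close>

definition d_op :: "'a::group_add set set \<Rightarrow> 'a set \<Rightarrow> 'a set" where
  "d_op q A = {h. (+) (- h) ` A \<in> q}"

definition d_closed :: "'a::group_add set set \<Rightarrow> bool" where
  "d_closed \<A> \<longleftrightarrow> (\<forall>A\<in>\<A>. \<forall>q. ultrafilter q powerset_alg \<longrightarrow> d_op q A \<in> \<A>)"

definition frakU :: "'a::topological_group_add set set set" where
  "frakU = {v. ultrafilter v RO_alg \<and> (\<forall>V. regular_open V \<and> 0 \<in> V \<longrightarrow> V \<in> v)}"

definition tidy_set :: "'a::topological_space set \<Rightarrow> bool" where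
  "tidy_set A \<longleftrightarrow> (\<exists>V. regular_open V \<and> V \<subseteq> A \<and> A \<subseteq> closure V)"

definition tidy :: "'a::topological_space set set \<Rightarrow> bool" where
  "tidy \<B> \<longleftrightarrow> (\<forall>B\<in>\<B>. tidy_set B)"

definition nowhere_dense :: "'a::topological_space set \<Rightarrow> bool" where
  "nowhere_dense A \<longleftrightarrow> interior (closure A) = {}"

definition iso_via ::
  "'a::topological_group_add set set \<Rightarrow> 'a set set \<Rightarrow> 'a set set \<Rightarrow> bool" where
  "iso_via q \<B> \<BB> \<longleftrightarrow>
     rho \<in> g_iso (powerset_alg\<lparr>carr := \<B>\<rparr>) (RO_alg\<lparr>carr := \<BB>\<rparr>) \<and>
     d_op q \<in> g_iso (RO_alg\<lparr>carr := \<BB>\<rparr>) (powerset_alg\<lparr>carr := \<B>\<rparr>) \<and>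
     (\<forall>B\<in>\<B>. d_op q (rho B) = B) \<and> (\<forall>V\<in>\<BB>. rho (d_op q V) = V)"


section \<open>The structures above are G-algebras\<close>

lemma g_algebra_subalgebra:
  assumes "g_algebra M" "g_subalgebra S M"
  shows "g_algebra (M\<lparr>carr := S\<rparr>)"
proof -
  interpret g_algebra M by fact
  have S: "a \<in> S \<Longrightarrow> a \<in> carr M" for a using assms(2) by (auto simp: g_subalgebra_def)
  show ?thesis
  proof (unfold_locales, goal_cases)
    case (6 a b) then show ?case using S join_comm by simp
  next
    case (7 a b) then show ?case using S meet_comm by simp
  next
    case (8 a b c) then show ?case using S join_meet_distrib by simp
  next
    case (9 a b c) then show ?case using S meet_join_distrib by simp
  qed (use assms(2) in \<open>simp_all add: g_subalgebra_def S join_bott meet_topp join_comp meet_comp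
        act_zero act_add act_join act_meet act_comp\<close>)
qed

lemma open_left_translate:
  fixes U :: "'a::topological_group_add set"
  assumes "open U"
  shows "open ((+) g ` U)"
proof -
  have "(+) g ` U = (+) (- g) -` U"
    by (auto simp: image_iff) (metis add_minus_cancel)
  then show ?thesis using assms
    by (auto intro!: open_vimage continuous_intros)
qed

lemma interior_left_translate:
  fixes A :: "'a::topological_group_add set"
  shows "interior ((+) g ` A) = (+) g ` interior A"
proof -
  have sub: "(+) h ` interior B \<subseteq> interior ((+) h ` B)" for h :: 'a and B
    by (intro interior_maximal image_mono interior_subset open_left_translate open_interior)
  have "(+) (- g) ` interior ((+) g ` A) \<subseteq> interior A"
    using sub[of "- g" "(+) g ` A"] by (simp add: image_image)
  then have "(+) g ` (+) (- g) ` interior ((+) g ` A) \<subseteq> (+) g ` interior A"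
    by (rule image_mono)
  then show ?thesis using sub[of g A] by (auto simp: image_image)
qed

lemma Compl_left_translate: "(+) g ` (- A) = - ((+) g ` (A :: 'a::group_add set))"
proof -
  have "surj ((+) g)" by (metis add_minus_cancel surjI)
  then show ?thesis by (simp add: bij_image_Compl_eq bij_def inj_on_def)
qed

lemma g_algebra_powerset: "g_algebra (powerset_alg :: ('a::group_add, 'a set) galg)"
proof -
  let ?M = "powerset_alg :: ('a, 'a set) galg"
  have [simp]: "carr ?M = UNIV" "join ?M = (\<union>)" "meet ?M = (\<inter>)" "cmpl ?M = uminus"
    "bott ?M = {}" "topp ?M = UNIV" "act ?M = (\<lambda>g A. (+) g ` A)"
    by (simp_all add: powerset_alg_def)
  show ?thesis
  proof
    fix a :: "'a set" and g h
    show "act ?M 0 a = a"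
      by auto
    show "act ?M (g + h) a = act ?M g (act ?M h a)"
      by (simp add: image_image flip: add.assoc)
    show "act ?M g (cmpl ?M a) = cmpl ?M (act ?M g a)"
      by (simp add: Compl_left_translate)
  qed (auto simp: image_Un image_Int)
qed

lemma closure_left_translate:
  fixes A :: "'a::topological_group_add set"
  shows "closure ((+) g ` A) = (+) g ` closure A"
  using interior_left_translate[of g "- A"]
  by (simp add: Compl_left_translate interior_complement)

lemma regular_open_rho: "regular_open (rho A)"
proof -
  have "closure (rho A) \<subseteq> closure A"
    unfolding rho_def by (intro closure_minimal interior_subset closed_closure)
  then have "interior (closure (rho A)) \<subseteq> rho A"
    unfolding rho_def by (rule interior_mono)
  moreover have "rho A \<subseteq> interior (closure (rho A))"
    by (intro interior_maximal closure_subset) (simp add: rho_def)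
  ultimately show ?thesis
    unfolding regular_open_def by (rule subset_antisym)
qed

lemma rho_regular_open: "regular_open U \<Longrightarrow> rho U = U"
  by (simp add: regular_open_def rho_def)

lemma open_regular_open: "regular_open U \<Longrightarrow> open U"
  by (metis open_interior regular_open_def)

lemma rho_Int:
  assumes "open U"
  shows "rho (U \<inter> V) = rho U \<inter> rho V"
proof -
  have "rho U \<inter> rho V \<subseteq> closure (U \<inter> V)"
  proof
    fix x assume x: "x \<in> rho U \<inter> rho V"
    show "x \<in> closure (U \<inter> V)"
      unfolding closure_iff_nhds_not_empty
    proof (intro allI impI)
      fix A S assume S: "S \<subseteq> A" "open S" "x \<in> S"
      have "open (S \<inter> rho V)" "x \<in> S \<inter> rho V" "x \<in> closure U"
        using x S interior_subset by (auto simp: rho_def)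
      then obtain y where y: "y \<in> U" "y \<in> S" "y \<in> rho V"
        unfolding closure_iff_nhds_not_empty by blast
      then have "open (S \<inter> U)" "y \<in> S \<inter> U" "y \<in> closure V"
        using assms S interior_subset by (auto simp: rho_def)
      then show "(U \<inter> V) \<inter> A \<noteq> {}"
        using S(1) unfolding closure_iff_nhds_not_empty by blast
    qed
  qed
  then have "rho U \<inter> rho V \<subseteq> rho (U \<inter> V)"
    unfolding rho_def[of "U \<inter> V"] by (intro interior_maximal) (auto simp: rho_def)
  moreover have "rho (U \<inter> V) \<subseteq> rho U \<inter> rho V"
    unfolding rho_def by (intro Int_greatest interior_mono closure_mono) auto
  ultimately show ?thesis by blast
qed

lemma g_algebra_RO: "g_algebra (RO_alg :: ('a::topological_group_add, 'a set) galg)"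
proof -
  let ?M = "RO_alg :: ('a, 'a set) galg"
  have [simp]: "carr ?M = {U. regular_open U}" "join ?M = (\<lambda>U V. rho (U \<union> V))"
    "meet ?M = (\<inter>)" "cmpl ?M = (\<lambda>U. interior (- U))" "bott ?M = {}" "topp ?M = UNIV"
    "act ?M = (\<lambda>g A. (+) g ` A)"
    by (auto simp: RO_alg_def rho_def)
  have tr: "rho ((+) g ` A) = (+) g ` rho A" for g :: 'a and A
    by (simp add: rho_def closure_left_translate interior_left_translate)
  have compl_rho: "interior (- U) = rho (- U)" if "regular_open U" for U :: "'a set"
    using that open_regular_open[OF that]
    by (simp add: rho_def closed_Compl)
  have compl_cl: "closure (interior (- U)) = - U" if "regular_open U" for U :: "'a set"
    using that by (simp add: regular_open_def interior_complement closure_complement)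
  show ?thesis
  proof
    fix a b c :: "'a set" and g
    assume ab: "a \<in> carr ?M" "b \<in> carr ?M"
    then show "meet ?M a b \<in> carr ?M"
      using regular_open_rho[of "a \<inter> b"] by (simp add: rho_Int open_regular_open rho_regular_open)
    show "act ?M g (join ?M a b) = join ?M (act ?M g a) (act ?M g b)"
      by (simp add: image_Un[symmetric] tr)
    show "act ?M g (meet ?M a b) = meet ?M (act ?M g a) (act ?M g b)"
      by (simp add: image_Int)
    assume c: "c \<in> carr ?M"
    show "join ?M a (meet ?M b c) = meet ?M (join ?M a b) (join ?M a c)"
      using ab c by (simp add: rho_Int[symmetric] open_regular_open open_Un Un_Int_distrib)
    show "meet ?M a (join ?M b c) = join ?M (meet ?M a b) (meet ?M a c)"
      using ab c rho_Int[of a "b \<union> c"]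
      by (simp add: open_regular_open rho_regular_open Int_Un_distrib)
  next
    fix a :: "'a set" and g h
    assume a: "a \<in> carr ?M"
    show "cmpl ?M a \<in> carr ?M"
      using a by (simp add: compl_rho regular_open_rho)
    have "closure a \<union> - a = UNIV"
      using closure_subset[of a] by blast
    then show "join ?M a (cmpl ?M a) = topp ?M"
      using a by (simp add: rho_def compl_cl)
    show "meet ?M a (cmpl ?M a) = bott ?M"
      using interior_subset[of "- a"] by auto
    show "act ?M g a \<in> carr ?M"
      using a tr[of g a] by (simp add: regular_open_def rho_def)
    show "act ?M g (cmpl ?M a) = cmpl ?M (act ?M g a)"
      using interior_left_translate[of g "- a"] by (simp add: Compl_left_translate)
    show "act ?M 0 a = a"
      by auto
    show "act ?M (g + h) a = act ?M g (act ?M h a)"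
      by (simp add: image_image flip: add.assoc)
  qed (simp_all add: regular_open_def[of "{}"] regular_open_def[of UNIV] regular_open_rho
      rho_regular_open Un_commute Int_commute)
qed

end

(*
  Homomorphisms are injective on generic algebras, because a generic element cannot be mapped to
  the bottom. Hence, given homomorphisms f and d in opposite directions with d o f the identity on
  a maximal generic subalgebra S, the image f ` S is again maximal generic: a larger generic algebra
  would be mapped by d injectively onto a generic algebra containing S. This is applied to rho and
  to d_u for several ultrafilters u of regular open sets. Each u extends to an ultrafilter p of the
  power set that also contains every dense open set; then d_u o rho = d_p on sets with the strong
  Baire property, so d-closedness keeps the values of d_u inside the algebra. For v in frakU, rho o d_v
  is the identity, which yields (i). For an arbitrary maximal generic subalgebra B0, any u containing
  all rho B with 0 in B in B0 has d_u o rho the identity on B0; if B0 is tidy, u can be chosen in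
  frakU, which yields (ii). Finally (iii) is obtained from d_v o rho.
*)
theory Submission
  imports Defs
begin

section \<open>Homomorphisms and generic algebras\<close>

text \<open>Injectivity is left out on purpose: on generic subalgebras it follows from genericity,
  so it only has to be established where an isomorphism is wanted.\<close>

definition g_hom :: "('g, 'b) galg \<Rightarrow> ('g, 'c) galg \<Rightarrow> ('b \<Rightarrow> 'c) set" where
  "g_hom M N = {f. f ` carr M \<subseteq> carr N \<and> f (bott M) = bott N \<and> f (topp M) = topp N \<and>
     (\<forall>a\<in>carr M. \<forall>b\<in>carr M. f (join M a b) = join N (f a) (f b) \<and>
                            f (meet M a b) = meet N (f a) (f b)) \<and>
     (\<forall>a\<in>carr M. f (cmpl M a) = cmpl N (f a)) \<and>
     (\<forall>g. \<forall>a\<in>carr M. f (act M g a) = act N g (f a))}"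

lemma g_hom_restrict_dom:
  assumes "f \<in> g_hom M N" "S \<subseteq> carr M"
  shows "f \<in> g_hom (M\<lparr>carr := S\<rparr>) N"
proof -
  have [simp]: "a \<in> carr M" if "a \<in> S" for a using assms(2) that by blast
  show ?thesis using assms(1) by (auto simp: g_hom_def)
qed

lemma g_hom_restrict:
  assumes "f \<in> g_hom M N" "S \<subseteq> carr M" "f ` S \<subseteq> T"
  shows "f \<in> g_hom (M\<lparr>carr := S\<rparr>) (N\<lparr>carr := T\<rparr>)"
  using g_hom_restrict_dom[OF assms(1,2)] assms(3) by (simp add: g_hom_def)

lemma g_hom_image_subalgebra:
  assumes f: "f \<in> g_hom M N" and S: "g_subalgebra S M"
  shows "g_subalgebra (f ` S) N"
proof -
  have sub: "a \<in> S \<Longrightarrow> a \<in> carr M" for a using S by (auto simp: g_subalgebra_def)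
  have "f (bott M) \<in> f ` S" "f (topp M) \<in> f ` S"
    using S by (simp_all add: g_subalgebra_def)
  then have "bott N \<in> f ` S" "topp N \<in> f ` S"
    using f by (simp_all add: g_hom_def)
  moreover have "join N (f a) (f b) \<in> f ` S" "meet N (f a) (f b) \<in> f ` S"
    if "a \<in> S" "b \<in> S" for a b
  proof -
    have "f (join M a b) \<in> f ` S" "f (meet M a b) \<in> f ` S"
      using S that by (simp_all add: g_subalgebra_def)
    then show "join N (f a) (f b) \<in> f ` S" "meet N (f a) (f b) \<in> f ` S"
      using f that by (simp_all add: g_hom_def sub)
  qed
  moreover have "cmpl N (f a) \<in> f ` S" "act N g (f a) \<in> f ` S" if "a \<in> S" for a g
  proof -
    have "f (cmpl M a) \<in> f ` S" "f (act M g a) \<in> f ` S"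
      using S that by (simp_all add: g_subalgebra_def)
    then show "cmpl N (f a) \<in> f ` S" "act N g (f a) \<in> f ` S"
      using f that by (simp_all add: g_hom_def sub)
  qed
  moreover have "f ` S \<subseteq> carr N" using f sub by (auto simp: g_hom_def)
  ultimately show ?thesis by (auto simp: g_subalgebra_def)
qed

lemma (in g_algebra) foldr_act_hom:
  assumes "f \<in> g_hom M N" "a \<in> carr M"
  shows "foldr (\<lambda>g b. join M (act M g a) b) gs (bott M) \<in> carr M \<and>
    f (foldr (\<lambda>g b. join M (act M g a) b) gs (bott M)) =
      foldr (\<lambda>g b. join N (act N g (f a)) b) gs (bott N)"
  \<comment> \<open>Membership in the carrier travels along in the induction, because
    \<open>f\<close> respects \<open>join\<close> only for arguments from the carrier.\<close>
  using assms
  by (induction gs) (auto simp: g_hom_def join_closed act_closed bott_closed)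

lemma (in g_algebra) generic_elem_hom:
  assumes "f \<in> g_hom M N" "a \<in> carr M" "generic_elem M a"
  shows "generic_elem N (f a)"
proof -
  obtain gs where gs: "gs \<noteq> []" "topp M = foldr (\<lambda>g b. join M (act M g a) b) gs (bott M)"
    using assms(3) by (auto simp: generic_elem_def)
  have "topp N = f (topp M)" using assms(1) by (simp add: g_hom_def)
  then show ?thesis
    using gs foldr_act_hom[OF assms(1,2), of gs] by (auto simp: generic_elem_def)
qed

lemma (in g_algebra) not_generic_bott:
  assumes "bott M \<noteq> topp M"
  shows "\<not> generic_elem M (bott M)"
proof
  \<comment> \<open>That the action fixes the bottom is not among the axioms; it follows by writing
    the bottom as the meet of the top with its complement.\<close>
  have act_bott: "act M g (bott M) = bott M" for g
  proof -
    have "act M g (bott M) = act M g (meet M (topp M) (cmpl M (topp M)))"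
      by (simp add: meet_comp topp_closed)
    also have "\<dots> = meet M (act M g (topp M)) (cmpl M (act M g (topp M)))"
      by (simp add: act_meet act_comp topp_closed comp_closed)
    also have "\<dots> = bott M" by (simp add: meet_comp topp_closed act_closed)
    finally show ?thesis .
  qed
  have "foldr (\<lambda>g b. join M (act M g (bott M)) b) gs (bott M) = bott M" for gs
    by (induction gs) (auto simp: act_bott join_bott bott_closed)
  moreover assume "generic_elem M (bott M)"
  ultimately show False using assms by (auto simp: generic_elem_def)
qed

text \<open>This reduces injectivity of a homomorphism to triviality of its kernel.\<close>

lemma (in g_algebra) eq_if_differences_bott:
  assumes "a \<in> carr M" "b \<in> carr M" "meet M a (cmpl M b) = bott M" "meet M b (cmpl M a) = bott M"
  shows "a = b"
proof -
  have le: "x = meet M x y" if "x \<in> carr M" "y \<in> carr M" "meet M x (cmpl M y) = bott M" for x y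
  proof -
    have "x = meet M x (join M y (cmpl M y))" using that by (simp add: join_comp meet_topp)
    also have "\<dots> = meet M x y"
      using that by (simp add: meet_join_distrib comp_closed join_bott meet_closed)
    finally show ?thesis .
  qed
  show ?thesis using le[of a b] le[of b a] assms by (simp add: meet_comm)
qed

text \<open>A non-bottom element of the kernel would be generic, and so its image, the bottom of
  \<open>N\<close>, would be generic too, which \<open>bott N \<noteq> topp N\<close> forbids. If
  \<open>f a = f b\<close>, both differences of \<open>a\<close> and \<open>b\<close> lie in the
  kernel.\<close>

lemma generic_hom_inj_on:
  assumes "g_algebra M" "generic_alg M" "g_algebra N" "f \<in> g_hom M N" "bott N \<noteq> topp N"
  shows "inj_on f (carr M)"
proof -
  interpret M: g_algebra M by fact
  interpret N: g_algebra N by fact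
  have ker: "a = bott M" if "a \<in> carr M" "f a = bott N" for a
    using that assms(2) M.generic_elem_hom[OF assms(4) that(1)] N.not_generic_bott[OF assms(5)]
    unfolding generic_alg_def by metis
  have diff: "meet M a (cmpl M b) = bott M" if "a \<in> carr M" "b \<in> carr M" "f a = f b" for a b
  proof (rule ker)
    have "f b \<in> carr N" using assms(4) that by (auto simp: g_hom_def)
    then show "f (meet M a (cmpl M b)) = bott N"
      using assms(4) that by (simp add: g_hom_def M.comp_closed N.meet_comp)
  qed (use that in \<open>simp add: M.meet_closed M.comp_closed\<close>)
  show ?thesis
  proof (rule inj_onI)
    fix a b assume "a \<in> carr M" "b \<in> carr M" "f a = f b"
    then show "a = b" by (intro M.eq_if_differences_bott[of a b] diff[of a b] diff[of b a]) simp_all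
  qed
qed

section \<open>Images of generic subalgebras and transfer of maximality\<close>

lemma generic_subalgebra_hom:
  assumes "g_algebra M" "f \<in> g_hom M N" "generic_subalgebra S M"
  shows "generic_subalgebra (f ` S) N"
proof -
  let ?S = "M\<lparr>carr := S\<rparr>" and ?N = "N\<lparr>carr := f ` S\<rparr>"
  have S: "g_subalgebra S M" "generic_alg ?S" using assms(3) by (auto simp: generic_subalgebra_def)
  interpret S: g_algebra ?S using g_algebra_subalgebra[OF assms(1) S(1)] .
  have f: "f \<in> g_hom ?S ?N"
    using assms(2) S(1) by (intro g_hom_restrict) (auto simp: g_subalgebra_def)
  have "generic_alg ?N"
    unfolding generic_alg_def
  proof (intro ballI impI)
    \<comment> \<open>A non-bottom value has a non-bottom preimage, and translates of the preimage
      joining to the top are mapped to translates of \<open>y\<close> joining to the top.\<close>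
    fix y assume "y \<in> carr ?N" "y \<noteq> bott ?N"
    moreover have "f (bott M) = bott N" using assms(2) by (simp add: g_hom_def)
    ultimately obtain a where a: "a \<in> S" "y = f a" "a \<noteq> bott M"
      by auto
    then have "generic_elem ?S a" using S(2) by (simp add: generic_alg_def)
    then show "generic_elem ?N y"
      using S.generic_elem_hom[OF f, of a] a by simp
  qed
  then show ?thesis
    using g_hom_image_subalgebra[OF assms(2) S(1)] by (simp add: generic_subalgebra_def)
qed

lemma generic_subalgebra_inj_on:
  assumes "g_algebra M" "g_algebra N" "f \<in> g_hom M N" "bott N \<noteq> topp N" "generic_subalgebra S M"
  shows "inj_on f S"
proof -
  have S: "g_subalgebra S M" "generic_alg (M\<lparr>carr := S\<rparr>)"
    using assms(5) by (auto simp: generic_subalgebra_def)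
  have "f \<in> g_hom (M\<lparr>carr := S\<rparr>) N"
    using g_hom_restrict_dom[OF assms(3)] S(1) by (simp add: g_subalgebra_def)
  from generic_hom_inj_on[OF g_algebra_subalgebra[OF assms(1) S(1)] S(2) assms(2) this assms(4)]
  show ?thesis by simp
qed

lemma maximal_generic_subalgebra_transfer:
  assumes "g_algebra M" "g_algebra N" "bott M \<noteq> topp M"
    and f: "f \<in> g_hom M N" and d: "d \<in> g_hom N M"
    and S: "maximal_generic_subalgebra S M" and df: "\<And>x. x \<in> S \<Longrightarrow> d (f x) = x"
  shows "maximal_generic_subalgebra (f ` S) N"
proof -
  have gS: "generic_subalgebra S M" using S by (simp add: maximal_generic_subalgebra_def)
  have "T = f ` S" if T: "generic_subalgebra T N" "f ` S \<subseteq> T" for T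
  proof -
    have "S \<subseteq> d ` T"
    proof
      fix x assume "x \<in> S"
      then show "x \<in> d ` T" using T(2) df[of x] by (intro image_eqI[of _ _ "f x"]) auto
    qed
    then have dT: "d ` T = S"
      using S generic_subalgebra_hom[OF assms(2) d T(1)]
      by (auto simp: maximal_generic_subalgebra_def)
    have inj: "inj_on d T"
      using generic_subalgebra_inj_on[OF assms(2,1) d assms(3) T(1)] .
    have "y \<in> f ` S" if "y \<in> T" for y
    proof -
      have dy: "d y \<in> S" using that dT by auto
      then have "f (d y) \<in> T" using T(2) by auto
      then have "f (d y) = y" using inj that df[OF dy] by (auto dest: inj_onD)
      then show ?thesis using dy by (metis imageI)
    qed
    then show ?thesis using T(2) by auto
  qed
  then have "\<not> (\<exists>T. generic_subalgebra T N \<and> f ` S \<subset> T)" by blast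
  then show ?thesis
    using generic_subalgebra_hom[OF assms(1) f gS] unfolding maximal_generic_subalgebra_def by blast
qed

lemma g_iso_iff_hom: "f \<in> g_iso M N \<longleftrightarrow> f \<in> g_hom M N \<and> bij_betw f (carr M) (carr N)"
  by (auto simp: g_iso_def g_hom_def bij_betw_def)

lemma g_iso_of_inverse_homs:
  assumes "f \<in> g_hom M N" "d \<in> g_hom N M" "S \<subseteq> carr M" "\<And>x. x \<in> S \<Longrightarrow> d (f x) = x"
  shows "f \<in> g_iso (M\<lparr>carr := S\<rparr>) (N\<lparr>carr := f ` S\<rparr>)"
    and "d \<in> g_iso (N\<lparr>carr := f ` S\<rparr>) (M\<lparr>carr := S\<rparr>)"
proof -
  have "f ` S \<subseteq> carr N" using assms(1,3) by (auto simp: g_hom_def)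
  moreover have "bij_betw f S (f ` S)" "bij_betw d (f ` S) S"
    using assms(4) by (auto intro!: bij_betw_byWitness[of _ d f] bij_betw_byWitness[of _ f d])
  ultimately show "f \<in> g_iso (M\<lparr>carr := S\<rparr>) (N\<lparr>carr := f ` S\<rparr>)"
    "d \<in> g_iso (N\<lparr>carr := f ` S\<rparr>) (M\<lparr>carr := S\<rparr>)"
    using assms by (auto simp: g_iso_iff_hom intro!: g_hom_restrict)
qed

lemma g_iso_comp:
  assumes "f \<in> g_iso M N" "d \<in> g_iso N K"
  shows "d \<circ> f \<in> g_iso M K"
proof -
  have "f a \<in> carr N" if "a \<in> carr M" for a
    using assms(1) that by (auto simp: g_iso_def bij_betw_def)
  then show ?thesis using assms by (auto simp: g_iso_def intro: bij_betw_trans)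
qed

section \<open>Ultrafilters\<close>

lemma ex_powerset_ultrafilter:
  fixes F :: "'a::group_add set set"
  assumes F: "F \<noteq> {}" "{} \<notin> F" "\<And>a b. a \<in> F \<Longrightarrow> b \<in> F \<Longrightarrow> a \<inter> b \<in> F"
  obtains p where "ultrafilter p (powerset_alg :: ('a, 'a set) galg)" "F \<subseteq> p"
proof -
  \<comment> \<open>Upward closure is not demanded of the members of \<open>Q\<close>; a maximal
    member acquires it below.\<close>
  define Q where "Q = {q. F \<subseteq> q \<and> {} \<notin> q \<and> (\<forall>a\<in>q. \<forall>b\<in>q. a \<inter> b \<in> q)}"
  have "\<exists>p\<in>Q. \<forall>X\<in>Q. p \<subseteq> X \<longrightarrow> X = p"
  proof (rule subset_Zorn_nonempty)
    show "Q \<noteq> {}" using F by (auto simp: Q_def)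
    fix C assume C: "C \<noteq> {}" "subset.chain Q C"
    have "a \<inter> b \<in> \<Union>C" if ab: "a \<in> q" "b \<in> r" "q \<in> C" "r \<in> C" for a b q r
    proof -
      have "q \<subseteq> r \<or> r \<subseteq> q" "q \<in> Q" "r \<in> Q"
        using C(2) ab(3,4) unfolding subset_chain_def by blast+
      then show ?thesis using ab unfolding Q_def by blast
    qed
    moreover have "F \<subseteq> \<Union>C" "{} \<notin> \<Union>C"
      using C unfolding subset_chain_def Q_def by blast+
    ultimately show "\<Union>C \<in> Q" unfolding Q_def by blast
  qed
  then obtain p where p: "p \<in> Q" "\<And>X. X \<in> Q \<Longrightarrow> p \<subseteq> X \<Longrightarrow> X = p" by auto
  have p_Int: "b \<inter> c \<in> p" if "b \<in> p" "c \<in> p" for b c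
    using p(1) that by (simp add: Q_def)
  \<comment> \<open>If \<open>a\<close> meets all members of \<open>p\<close>, the supersets of the
    sets \<open>b \<inter> a\<close> with \<open>b\<close> in \<open>p\<close> form a member of
    \<open>Q\<close> above \<open>p\<close>, hence \<open>p\<close> itself. The case
    \<open>a = UNIV\<close> gives upward closure, and an arbitrary \<open>a\<close> gives the
    dichotomy between \<open>a\<close> and \<open>- a\<close>.\<close>
  have in_p: "x \<in> p" if a: "\<forall>b\<in>p. b \<inter> a \<noteq> {}" "b \<in> p" "b \<inter> a \<subseteq> x" for a b x
  proof -
    let ?X = "{x. \<exists>b\<in>p. b \<inter> a \<subseteq> x}"
    have "\<forall>y\<in>?X. \<forall>z\<in>?X. y \<inter> z \<in> ?X"
    proof (intro ballI)
      fix y z assume "y \<in> ?X" "z \<in> ?X"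
      then obtain b c where *: "b \<in> p" "b \<inter> a \<subseteq> y" "c \<in> p" "c \<inter> a \<subseteq> z" by blast
      then have "b \<inter> c \<in> p" using p_Int by blast
      moreover have "b \<inter> c \<inter> a \<subseteq> y \<inter> z" using * by blast
      ultimately show "y \<inter> z \<in> ?X" by blast
    qed
    moreover have "F \<subseteq> ?X" using p(1) unfolding Q_def by blast
    moreover have "{} \<notin> ?X" using a(1) by blast
    ultimately have "?X \<in> Q" by (simp add: Q_def)
    then have "?X = p" by (rule p(2)) auto
    then show ?thesis using a by blast
  qed
  have nonempty: "\<forall>b\<in>p. b \<inter> UNIV \<noteq> {}" using p(1) by (auto simp: Q_def)
  have up: "x \<in> p" if "b \<in> p" "b \<subseteq> x" for b x
    using in_p[OF nonempty that(1), of x] that(2) by simp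
  obtain f where "f \<in> p" using F p(1) by (auto simp: Q_def)
  have compl: "a \<in> p \<or> - a \<in> p" for a
  proof (cases "\<forall>b\<in>p. b \<inter> a \<noteq> {}")
    case True
    then show ?thesis using in_p[OF True \<open>f \<in> p\<close>, of a] by auto
  next
    case False
    then obtain b where "b \<in> p" "b \<subseteq> - a" by auto
    then show ?thesis using up by auto
  qed
  have "UNIV \<in> p" by (rule up[OF \<open>f \<in> p\<close>]) simp
  moreover have "F \<subseteq> p" "{} \<notin> p" using p(1) by (simp_all add: Q_def)
  moreover have "b \<in> p" if "a \<in> p" "a \<inter> b = a" for a b
    by (rule up[OF that(1)]) (use that(2) in blast)
  ultimately have "ultrafilter p powerset_alg"
    unfolding ultrafilter_def powerset_alg_def galg.simps
    using p_Int compl by (intro conjI ballI impI) (assumption | rule subset_UNIV)+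
  then show thesis using that \<open>F \<subseteq> p\<close> by blast
qed

text \<open>Dense open sets can be added because a nonempty open set meets each of them, and the
  intersection of two dense open sets is again dense open. An ultrafilter containing them sees only
  what a set with the strong Baire property does on the dense open set where it is decided.\<close>

lemma ex_powerset_ultrafilter_dense_open:
  fixes F :: "'a::topological_group_add set set"
  assumes F: "F \<noteq> {}" "{} \<notin> F" "\<And>a. a \<in> F \<Longrightarrow> open a"
    "\<And>a b. a \<in> F \<Longrightarrow> b \<in> F \<Longrightarrow> a \<inter> b \<in> F"
  obtains p where "ultrafilter p (powerset_alg :: ('a, 'a set) galg)" "F \<subseteq> p"
    "{D. open D \<and> closure D = UNIV} \<subseteq> p"
proof -
  define G where "G = {V \<inter> D | V D. V \<in> F \<and> open D \<and> closure D = UNIV}"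
  have G_mem: "V \<inter> D \<in> G" if "V \<in> F" "open D" "closure D = UNIV" for V D
    unfolding G_def using that by blast
  have dense: "closure (V \<inter> D) = closure V" if "open V" "closure D = UNIV" for V D :: "'a set"
  proof
    show "closure V \<subseteq> closure (V \<inter> D)"
      using open_Int_closure_subset[OF that(1), of D] that(2)
      by (metis closure_minimal closed_closure inf_top_right)
  qed (simp add: closure_mono)
  have F_sub: "F \<subseteq> G" using G_mem[of _ UNIV] by auto
  then have "G \<noteq> {}" using F(1) by auto
  moreover have "{} \<notin> G"
  proof
    assume "{} \<in> G"
    then obtain V D where V: "V \<in> F" "closure D = UNIV" "V \<inter> D = {}" unfolding G_def by auto
    then have "closure V = {}" using dense[of V D] F(3)[of V] by simp
    then show False using V(1) F(2) by simp
  qed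
  moreover have "a \<inter> b \<in> G" if ab: "a \<in> G" "b \<in> G" for a b
  proof -
    obtain V D where a: "a = V \<inter> D" "V \<in> F" "open D" "closure D = UNIV"
      using ab(1) unfolding G_def by blast
    obtain W E where b: "b = W \<inter> E" "W \<in> F" "open E" "closure E = UNIV"
      using ab(2) unfolding G_def by blast
    have "a \<inter> b = (V \<inter> W) \<inter> (D \<inter> E)" using a(1) b(1) by blast
    moreover have "closure (D \<inter> E) = UNIV" using dense[of D E] a b by simp
    ultimately show ?thesis using G_mem[OF F(4)[OF a(2) b(2)] open_Int[OF a(3) b(3)]] by simp
  qed
  ultimately obtain p where p: "ultrafilter p (powerset_alg :: ('a, 'a set) galg)" "G \<subseteq> p"
    by (rule ex_powerset_ultrafilter)
  have up: "b \<in> p" if "a \<in> p" "a \<subseteq> b" for a b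
  proof -
    have "a \<inter> b = a" using that(2) by auto
    then show ?thesis using p(1) that(1) by (auto simp: ultrafilter_def powerset_alg_def)
  qed
  show thesis
  proof (rule that[OF p(1)])
    show "F \<subseteq> p" using F_sub p(2) by (rule subset_trans)
    show "{D. open D \<and> closure D = UNIV} \<subseteq> p"
    proof clarify
      fix D :: "'a set" assume D: "open D" "closure D = UNIV"
      obtain V where "V \<in> F" using F(1) by auto
      then have "V \<inter> D \<in> p" using G_mem D p(2) by blast
      then show "D \<in> p" by (rule up) simp
    qed
  qed
qed

lemma powerset_ultrafilter_simps:
  assumes "ultrafilter p (powerset_alg :: ('a::group_add, 'a set) galg)"
  shows "- a \<in> p \<longleftrightarrow> a \<notin> p" "a \<inter> b \<in> p \<longleftrightarrow> a \<in> p \<and> b \<in> p" "UNIV \<in> p" "{} \<notin> p"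
proof -
  have p: "UNIV \<in> p" "{} \<notin> p" "\<And>a b. a \<in> p \<Longrightarrow> b \<in> p \<Longrightarrow> a \<inter> b \<in> p"
    "\<And>a b. a \<in> p \<Longrightarrow> a \<inter> b = a \<Longrightarrow> b \<in> p" "\<And>a. a \<in> p \<or> - a \<in> p"
    using assms by (auto simp: ultrafilter_def powerset_alg_def)
  then show "UNIV \<in> p" "{} \<notin> p" by auto
  show "- a \<in> p \<longleftrightarrow> a \<notin> p" using p(2) p(3)[of a "- a"] p(5)[of a] by auto
  show "a \<inter> b \<in> p \<longleftrightarrow> a \<in> p \<and> b \<in> p"
    using p(3)[of a b] p(4)[of "a \<inter> b" a] p(4)[of "a \<inter> b" b] by (auto simp: Int_commute Int_left_commute)
qed

section \<open>Ultrafilters of regular open sets\<close>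

lemma regular_open_Int:
  "regular_open U \<Longrightarrow> regular_open V \<Longrightarrow> regular_open (U \<inter> V)"
  by (metis open_regular_open regular_open_rho rho_Int rho_regular_open)

text \<open>De Morgan's law for \<open>RO_alg\<close>: it lets preservation of joins be deduced from
  preservation of meets and complements.\<close>

lemma interior_closure_Un:
  "interior (closure (U \<union> V)) = interior (- (interior (- U) \<inter> interior (- V)))"
  by (simp add: interior_complement)

lemma regular_open_interior_Compl:
  assumes "regular_open U" shows "regular_open (interior (- U))"
proof -
  have "interior (- U) = rho (- U)"
    using open_regular_open[OF assms] by (simp add: rho_def closed_Compl)
  then show ?thesis by (simp add: regular_open_rho)
qed

text \<open>The ultrafilter is the trace on the regular open sets of a power set ultrafilter
  containing \<open>F\<close> and all dense open sets. For regular open \<open>a\<close>, the set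
  \<open>a \<union> interior (- a)\<close> is dense open, so the trace contains one of the two
  pieces.\<close>

lemma ex_RO_ultrafilter:
  fixes F :: "'a::topological_group_add set set"
  assumes F: "F \<noteq> {}" "{} \<notin> F" "\<And>a. a \<in> F \<Longrightarrow> regular_open a"
    "\<And>a b. a \<in> F \<Longrightarrow> b \<in> F \<Longrightarrow> a \<inter> b \<in> F"
  obtains u where "ultrafilter u (RO_alg :: ('a, 'a set) galg)" "F \<subseteq> u"
proof -
  obtain p where p: "ultrafilter p (powerset_alg :: ('a, 'a set) galg)" "F \<subseteq> p"
    "{D. open D \<and> closure D = UNIV} \<subseteq> p"
    using ex_powerset_ultrafilter_dense_open[OF F(1,2) open_regular_open[OF F(3)] F(4)] by blast
  note [simp] = powerset_ultrafilter_simps[OF p(1)]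
  have "interior (- a) \<in> p" if "regular_open a" "a \<notin> p" for a
  proof -
    have "closure (a \<union> interior (- a)) = closure a \<union> - a"
      using that(1) by (simp add: regular_open_def interior_complement closure_complement)
    also have "\<dots> = UNIV" using closure_subset[of a] by blast
    finally have "a \<union> interior (- a) \<in> {D. open D \<and> closure D = UNIV}"
      using open_regular_open[OF that(1)] by (simp add: open_Un del: closure_Un)
    then have "a \<union> interior (- a) \<in> p" by (rule subsetD[OF p(3)])
    then have "(a \<union> interior (- a)) \<inter> - a \<in> p" using that(2) by simp
    moreover have "(a \<union> interior (- a)) \<inter> - a = interior (- a)"
      using interior_subset[of "- a"] by blast
    ultimately show ?thesis by (simp only:)
  qed
  then have compl: "a \<in> p \<or> interior (- a) \<in> p" if "regular_open a" for a using that by blast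
  have up: "b \<in> p" if "a \<in> p" "a \<inter> b = a" for a b
    using powerset_ultrafilter_simps(2)[OF p(1), of a b] that by simp
  have UNIV: "regular_open (UNIV :: 'a set)" by (simp add: regular_open_def)
  have "ultrafilter {V \<in> p. regular_open V} RO_alg"
    unfolding ultrafilter_def RO_alg_def galg.simps
  proof (intro conjI ballI impI)
    fix a b assume "a \<in> {V \<in> p. regular_open V}" "b \<in> {U. regular_open U}" "a \<inter> b = a"
    then show "b \<in> {V \<in> p. regular_open V}" using up[of a b] by simp
  next
    fix a :: "'a set" assume "a \<in> {U. regular_open U}"
    then show "a \<in> {V \<in> p. regular_open V} \<or> interior (- a) \<in> {V \<in> p. regular_open V}"
      using compl[of a] regular_open_interior_Compl[of a] by simp
  qed (use UNIV in \<open>auto simp: regular_open_Int\<close>)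
  then show thesis
  proof (rule that)
    show "F \<subseteq> {V \<in> p. regular_open V}"
    proof
      fix V assume "V \<in> F"
      then show "V \<in> {V \<in> p. regular_open V}" using F(3)[of V] p(2) by blast
    qed
  qed
qed

lemma RO_ultrafilter_simps:
  assumes u: "ultrafilter u (RO_alg :: ('a::topological_group_add, 'a set) galg)"
  shows "regular_open a \<Longrightarrow> interior (- a) \<in> u \<longleftrightarrow> a \<notin> u"
    "regular_open a \<Longrightarrow> regular_open b \<Longrightarrow> a \<inter> b \<in> u \<longleftrightarrow> a \<in> u \<and> b \<in> u"
    "UNIV \<in> u" "{} \<notin> u" "a \<in> u \<Longrightarrow> regular_open a"
proof -
  have p: "UNIV \<in> u" "{} \<notin> u" "\<And>a b. a \<in> u \<Longrightarrow> b \<in> u \<Longrightarrow> a \<inter> b \<in> u"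
    "\<And>a b. a \<in> u \<Longrightarrow> regular_open b \<Longrightarrow> a \<inter> b = a \<Longrightarrow> b \<in> u"
    "\<And>a. regular_open a \<Longrightarrow> a \<in> u \<or> interior (- a) \<in> u"
    using u by (auto simp: ultrafilter_def RO_alg_def)
  then show "UNIV \<in> u" "{} \<notin> u" by auto
  show "a \<in> u \<Longrightarrow> regular_open a" using u by (auto simp: ultrafilter_def RO_alg_def)
  have "a \<inter> interior (- a) = {}" using interior_subset[of "- a"] by auto
  then show "regular_open a \<Longrightarrow> interior (- a) \<in> u \<longleftrightarrow> a \<notin> u"
    using p(2) p(3)[of a "interior (- a)"] p(5)[of a] by auto
  show "regular_open a \<Longrightarrow> regular_open b \<Longrightarrow> a \<inter> b \<in> u \<longleftrightarrow> a \<in> u \<and> b \<in> u"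
    using p(3)[of a b] p(4)[of "a \<inter> b" a] p(4)[of "a \<inter> b" b] by (auto simp: Int_commute Int_left_commute)
qed

section \<open>The homomorphisms between sets and regular open sets\<close>

lemma rho_left_translate:
  fixes A :: "'a::topological_group_add set"
  shows "rho ((+) g ` A) = (+) g ` rho A"
  by (simp add: rho_def closure_left_translate interior_left_translate)

lemma regular_open_left_translate:
  fixes A :: "'a::topological_group_add set"
  shows "regular_open A \<Longrightarrow> regular_open ((+) g ` A)"
  by (metis regular_open_rho rho_left_translate rho_regular_open)

lemma d_op_hom:
  fixes u :: "'a::topological_group_add set set"
  assumes u: "ultrafilter u RO_alg"
  shows "d_op u \<in> g_hom RO_alg powerset_alg"
proof -
  note [simp] = RO_ultrafilter_simps(1-4)[OF u] regular_open_left_translate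
  have surj: "surj ((+) g)" for g :: 'a by (metis add_minus_cancel surjI)
  have meet: "d_op u (a \<inter> b) = d_op u a \<inter> d_op u b" if "regular_open a" "regular_open b" for a b
    using that by (auto simp: d_op_def image_Int)
  have cmpl: "d_op u (interior (- a)) = - d_op u a" if "regular_open a" for a
    using that by (auto simp: d_op_def interior_left_translate[symmetric] Compl_left_translate)
  have join: "d_op u (interior (closure (a \<union> b))) = d_op u a \<union> d_op u b"
    if "regular_open a" "regular_open b" for a b
  proof -
    have "d_op u (interior (closure (a \<union> b))) = - (- d_op u a \<inter> - d_op u b)"
      using that
      by (simp only: interior_closure_Un cmpl meet regular_open_Int regular_open_interior_Compl)
    then show ?thesis by blast
  qed
  have act: "d_op u ((+) g ` a) = (+) g ` d_op u a" for g a
  proof -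
    \<comment> \<open>The group need not be commutative: the identity behind this is
      \<open>- h + g = - (- g + h)\<close>.\<close>
    have "h \<in> d_op u ((+) g ` a) \<longleftrightarrow> - g + h \<in> d_op u a" for h
      by (simp add: d_op_def image_image minus_add add.assoc)
    moreover have "h \<in> (+) g ` X \<longleftrightarrow> - g + h \<in> X" for h and X :: "'a set"
      by (auto simp: image_iff) (metis add_minus_cancel)
    ultimately show ?thesis by blast
  qed
  have "d_op u {} = {}" "d_op u UNIV = UNIV" using surj by (auto simp: d_op_def)
  then show ?thesis
    using meet cmpl join act by (auto simp: g_hom_def RO_alg_def powerset_alg_def)
qed

text \<open>Inside \<open>rho A\<close> the dense open set \<open>?D\<close> reduces to
  \<open>interior A\<close>, since \<open>interior (- A)\<close> is disjoint from
  \<open>closure A\<close>. Replacing \<open>A\<close> by its interior makes \<open>rho_Int\<close>,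
  which concerns open sets, applicable.\<close>

lemma rho_interior:
  assumes "A \<in> SBP" shows "rho (interior A) = rho A"
proof
  let ?D = "interior A \<union> interior (- A)"
  show "rho (interior A) \<subseteq> rho A"
    unfolding rho_def by (intro interior_mono closure_mono interior_subset)
  have "rho A \<inter> ?D \<subseteq> interior A"
    using interior_subset[of "closure A"] by (auto simp: rho_def interior_complement)
  moreover have "rho A \<subseteq> closure (rho A \<inter> ?D)"
    using open_Int_closure_subset[of "rho A" ?D] assms by (simp add: rho_def SBP_def)
  ultimately have "rho A \<subseteq> closure (interior A)" using closure_mono by blast
  then show "rho A \<subseteq> rho (interior A)"
    unfolding rho_def[of "interior A"] by (intro interior_maximal) (auto simp: rho_def)
qed

lemma rho_hom:
  fixes \<A> :: "'a::topological_group_add set set"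
  assumes "g_subalgebra \<A> powerset_alg" "\<A> \<subseteq> SBP"
  shows "rho \<in> g_hom (powerset_alg\<lparr>carr := \<A>\<rparr>) RO_alg"
proof -
  have A: "- a \<in> \<A>" "a \<inter> b \<in> \<A>" if "a \<in> \<A>" "b \<in> \<A>" for a b
    using assms(1) that by (auto simp: g_subalgebra_def powerset_alg_def)
  have int: "rho (interior a) = rho a" if "a \<in> \<A>" for a
    using assms(2) that rho_interior by auto
  have meet: "rho (a \<inter> b) = rho a \<inter> rho b" if "a \<in> \<A>" "b \<in> \<A>" for a b
    using int[OF A(2)[OF that]] that by (simp add: rho_Int int)
  \<comment> \<open>Once \<open>- a\<close> is replaced by its interior, namely the complement of
    \<open>closure a\<close>, the remaining closure and interior dualise to the right-hand
    side.\<close>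
  have cmpl: "rho (- a) = interior (- rho a)" if "a \<in> \<A>" for a
  proof -
    have "rho (- a) = rho (interior (- a))" using int[OF A(1)[OF that that]] by simp
    then show ?thesis by (simp add: rho_def interior_complement closure_complement)
  qed
  have join: "rho (a \<union> b) = interior (closure (rho a \<union> rho b))" if "a \<in> \<A>" "b \<in> \<A>" for a b
  proof -
    have "rho (a \<union> b) = rho (- (- a \<inter> - b))" by simp
    also have "\<dots> = interior (- (interior (- rho a) \<inter> interior (- rho b)))"
      using that A by (simp only: cmpl meet)
    finally show ?thesis by (simp only: interior_closure_Un)
  qed
  have "rho ({} :: 'a set) = {}" "rho (UNIV :: 'a set) = UNIV" by (auto simp: rho_def)
  then show ?thesis
    using meet cmpl join
    by (auto simp: g_hom_def RO_alg_def powerset_alg_def regular_open_rho rho_left_translate)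
qed

text \<open>Extend \<open>u\<close> to a power set ultrafilter \<open>p\<close> containing all dense
  open sets. Then \<open>p\<close> contains a member of \<open>\<A>\<close> exactly when
  \<open>u\<close> contains its image under \<open>rho\<close>, so \<open>d_op u (rho A)\<close> is
  \<open>d_op p A\<close>, to which d-closedness applies.\<close>

lemma d_op_rho_mem:
  fixes \<A> :: "'a::topological_group_add set set"
  assumes \<A>: "g_subalgebra \<A> powerset_alg" "\<A> \<subseteq> SBP" "d_closed \<A>"
    and u: "ultrafilter u (RO_alg :: ('a, 'a set) galg)" and "A \<in> \<A>"
  shows "d_op u (rho A) \<in> \<A>"
proof -
  note us = RO_ultrafilter_simps[OF u]
  have "u \<noteq> {}" using us(3) by blast
  moreover have "a \<inter> b \<in> u" if "a \<in> u" "b \<in> u" for a b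
    using us(2)[OF us(5)[OF that(1)] us(5)[OF that(2)]] that by simp
  ultimately obtain p where p: "ultrafilter p (powerset_alg :: ('a, 'a set) galg)" "u \<subseteq> p"
    "{D. open D \<and> closure D = UNIV} \<subseteq> p"
    using ex_powerset_ultrafilter_dense_open[OF _ us(4) open_regular_open[OF us(5)]] by blast
  note ps = powerset_ultrafilter_simps[OF p(1)]
  \<comment> \<open>On the dense open set \<open>?D\<close>, which belongs to \<open>p\<close>, a
    point of \<open>rho B\<close> cannot lie in \<open>interior (- B)\<close> and is therefore in
    \<open>B\<close>.\<close>
  have imp: "B \<in> p" if B: "B \<in> \<A>" "rho B \<in> u" for B
  proof -
    let ?D = "interior B \<union> interior (- B)"
    have "B \<in> SBP" using B(1) \<A>(2) by auto
    then have "?D \<in> {D. open D \<and> closure D = UNIV}"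
      unfolding SBP_def by (simp add: open_Un del: closure_Un)
    then have "?D \<in> p" by (rule subsetD[OF p(3)])
    then have "rho B \<inter> ?D \<in> p" using B p(2) ps(2) by blast
    moreover have "rho B \<inter> ?D \<inter> B = rho B \<inter> ?D"
      using interior_subset[of "closure B"] interior_subset[of B]
      by (auto simp: rho_def interior_complement)
    ultimately have "rho B \<inter> ?D \<inter> B \<in> p" by (simp only:)
    then show ?thesis by (simp only: ps(2))
  qed
  \<comment> \<open>The converse is \<open>imp\<close> for \<open>- B\<close>, as \<open>rho\<close>
    turns complements into complements in \<open>RO_alg\<close>.\<close>
  have iff: "B \<in> p \<longleftrightarrow> rho B \<in> u" if B: "B \<in> \<A>" for B
  proof (cases "rho B \<in> u")
    case False
    have cB: "- B \<in> \<A>" using B \<A>(1) by (auto simp: g_subalgebra_def powerset_alg_def)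
    have "rho (- B) = interior (- rho B)"
      using rho_hom[OF \<A>(1,2)] B by (simp add: g_hom_def RO_alg_def powerset_alg_def)
    then have "- B \<in> p" using False imp[OF cB] us(1)[OF regular_open_rho] by simp
    then show ?thesis using False ps(1) by auto
  qed (use imp that in auto)
  have "(+) g ` A \<in> \<A>" for g
    using \<A>(1) \<open>A \<in> \<A>\<close> by (auto simp: g_subalgebra_def powerset_alg_def)
  then have "d_op u (rho A) = d_op p A"
    by (simp add: d_op_def iff rho_left_translate[symmetric])
  moreover have "d_op p A \<in> \<A>"
    using \<A>(3) p(1) \<open>A \<in> \<A>\<close> unfolding d_closed_def by blast
  ultimately show ?thesis by (simp only:)
qed

section \<open>Ultrafilters for which \<open>rho\<close> and \<open>d_op\<close> invert each
  other\<close>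

lemma d_op_frakU:
  fixes V :: "'a::topological_group_add set"
  assumes v: "v \<in> frakU" and V: "regular_open V"
  shows "V \<subseteq> d_op v V" "d_op v V \<subseteq> closure V"
proof -
  have uf: "ultrafilter v RO_alg" using v by (simp add: frakU_def)
  \<comment> \<open>For \<open>h\<close> in \<open>W\<close>, the translate of \<open>W\<close> by
    \<open>- h\<close> is a regular open neighbourhood of \<open>0\<close>, hence a member of
    \<open>v\<close>.\<close>
  have sub: "W \<subseteq> d_op v W" if "regular_open W" for W :: "'a set"
  proof
    fix h assume "h \<in> W"
    then have "0 \<in> (+) (- h) ` W" by (auto intro!: rev_image_eqI)
    then show "h \<in> d_op v W"
      using v regular_open_left_translate[OF that] by (auto simp: frakU_def d_op_def)
  qed
  show "V \<subseteq> d_op v V" using sub V .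
  \<comment> \<open>The upper bound is the lower bound for the complement of \<open>V\<close> in
    \<open>RO_alg\<close>.\<close>
  have "d_op v (interior (- V)) = - d_op v V"
    using d_op_hom[OF uf] V by (simp add: g_hom_def RO_alg_def powerset_alg_def)
  then show "d_op v V \<subseteq> closure V"
    using sub[OF regular_open_interior_Compl[OF V]] by (auto simp: interior_complement)
qed

lemma rho_eq_of_between:
  assumes "regular_open V" "V \<subseteq> A" "A \<subseteq> closure V"
  shows "rho A = V"
proof -
  have "closure A = closure V"
    using assms(2,3) by (intro subset_antisym closure_minimal closure_mono) auto
  then show ?thesis using assms(1) by (simp add: rho_def regular_open_def)
qed

text \<open>Applied to complements as well, \<open>mem\<close> becomes an equivalence between
  \<open>rho C \<in> u\<close> and \<open>0 \<in> C\<close>. Taking for \<open>C\<close> the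
  translate of \<open>B\<close> by \<open>- h\<close> then says that \<open>h\<close> is in
  \<open>d_op u (rho B)\<close> exactly when it is in \<open>B\<close>.\<close>

lemma d_op_rho_eqI:
  fixes \<B> :: "'a::topological_group_add set set"
  assumes \<B>: "g_subalgebra \<B> powerset_alg" "\<B> \<subseteq> SBP"
    and u: "ultrafilter u (RO_alg :: ('a, 'a set) galg)"
    and mem: "\<And>B. B \<in> \<B> \<Longrightarrow> 0 \<in> B \<Longrightarrow> rho B \<in> u"
    and B: "B \<in> \<B>"
  shows "d_op u (rho B) = B"
proof -
  have iff: "rho C \<in> u \<longleftrightarrow> 0 \<in> C" if C: "C \<in> \<B>" for C
  proof (cases "0 \<in> C")
    case False
    have "- C \<in> \<B>" using C \<B>(1) by (auto simp: g_subalgebra_def powerset_alg_def)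
    then have "rho (- C) \<in> u" using False by (intro mem) auto
    moreover have "rho (- C) = interior (- rho C)"
      using rho_hom[OF \<B>] C by (simp add: g_hom_def RO_alg_def powerset_alg_def)
    ultimately show ?thesis
      using False RO_ultrafilter_simps(1)[OF u regular_open_rho] by simp
  qed (use mem C in auto)
  have "(+) g ` B \<in> \<B>" for g
    using \<B>(1) B by (auto simp: g_subalgebra_def powerset_alg_def)
  moreover have "0 \<in> (+) (- h) ` B \<longleftrightarrow> h \<in> B" for h
    by (auto simp: image_iff) (metis add.right_inverse add_minus_cancel minus_add_cancel left_minus)+
  ultimately show ?thesis
    by (auto simp: d_op_def iff rho_left_translate[symmetric])
qed

theorem theorem4p57:
  fixes \<A> \<AA> :: "'a::topological_group_add set set" and v :: "'a set set"
  assumes "g_subalgebra \<A> powerset_alg"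
    and "\<A> \<subseteq> SBP"
    and "d_closed \<A>"
    and "\<AA> = rho ` \<A>"
    and "v \<in> frakU"
  shows
    "(\<forall>\<BB>. maximal_generic_subalgebra \<BB> (RO_alg\<lparr>carr := \<AA>\<rparr>) \<longrightarrow>
        (\<exists>\<B>. maximal_generic_subalgebra \<B> (powerset_alg\<lparr>carr := \<A>\<rparr>) \<and> tidy \<B> \<and>
             iso_via v \<B> \<BB>)) \<and>
     (\<forall>\<B>. maximal_generic_subalgebra \<B> (powerset_alg\<lparr>carr := \<A>\<rparr>) \<and> tidy \<B> \<longrightarrow>
        (\<exists>u\<in>frakU. \<exists>\<BB>. maximal_generic_subalgebra \<BB> (RO_alg\<lparr>carr := \<AA>\<rparr>) \<and>
             iso_via u \<B> \<BB>)) \<and>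
     (\<forall>\<B>\<^sub>0. maximal_generic_subalgebra \<B>\<^sub>0 (powerset_alg\<lparr>carr := \<A>\<rparr>) \<longrightarrow>
        (\<exists>\<BB> \<B> \<phi>. maximal_generic_subalgebra \<BB> (RO_alg\<lparr>carr := \<AA>\<rparr>) \<and>
             maximal_generic_subalgebra \<B> (powerset_alg\<lparr>carr := \<A>\<rparr>) \<and> tidy \<B> \<and>
             \<phi> \<in> g_iso (powerset_alg\<lparr>carr := \<B>\<^sub>0\<rparr>) (powerset_alg\<lparr>carr := \<B>\<rparr>) \<and>
             iso_via v \<B> \<BB> \<and>
             (\<forall>B\<in>\<B>\<^sub>0. nowhere_dense (sym_diff (\<phi> B) B))))"
proof -
  let ?P = "powerset_alg :: ('a, 'a set) galg" and ?R = "RO_alg :: ('a, 'a set) galg"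
  let ?M = "?P\<lparr>carr := \<A>\<rparr>" and ?N = "?R\<lparr>carr := \<AA>\<rparr>"
  note \<A> = assms(1,2)
  have M: "g_algebra ?M" using g_algebra_subalgebra[OF g_algebra_powerset assms(1)] .
  have "g_subalgebra \<A> ?M"
    using assms(1) by (simp add: g_subalgebra_def)
  then have \<AA>: "g_subalgebra \<AA> ?R"
    unfolding assms(4) by (rule g_hom_image_subalgebra[OF rho_hom[OF \<A>]])
  have N: "g_algebra ?N" using g_algebra_subalgebra[OF g_algebra_RO \<AA>] .
  have nontriv: "bott ?M \<noteq> topp ?M" "bott ?N \<noteq> topp ?N"
    by (simp_all add: powerset_alg_def RO_alg_def)
  have rho: "rho \<in> g_hom ?M ?N"
    using g_hom_restrict[OF rho_hom[OF \<A>], of \<A> \<AA>] assms(4) by simp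
  \<comment> \<open>That the values stay in \<open>\<A>\<close> is where d-closedness enters,
    through \<open>d_op_rho_mem\<close>.\<close>
  have d: "d_op u \<in> g_hom ?N ?M" if "ultrafilter u ?R" for u
    using g_hom_restrict[OF d_op_hom[OF that], of \<AA> \<A>] \<AA> d_op_rho_mem[OF assms(1-3) that] assms(4)
    by (auto simp: g_subalgebra_def)
  have v: "ultrafilter v ?R" using assms(5) by (simp add: frakU_def)
  have sub_M: "\<B> \<subseteq> \<A>" "g_subalgebra \<B> ?P" "\<B> \<subseteq> SBP" "inj_on rho \<B>"
    if "maximal_generic_subalgebra \<B> ?M" for \<B>
  proof -
    have "generic_subalgebra \<B> ?M" using that by (simp add: maximal_generic_subalgebra_def)
    then show "inj_on rho \<B>" using generic_subalgebra_inj_on[OF M N rho nontriv(2)] by blast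
    show "\<B> \<subseteq> \<A>" "g_subalgebra \<B> ?P" "\<B> \<subseteq> SBP"
      using \<open>generic_subalgebra \<B> ?M\<close> assms(2)
      by (auto simp: generic_subalgebra_def g_subalgebra_def powerset_alg_def)
  qed
  have rho_d: "rho (d_op v V) = V" if "regular_open V" for V
    using rho_eq_of_between[OF that d_op_frakU[OF assms(5) that]] .
  have RO: "regular_open V" if "V \<in> \<AA>" for V using that assms(4) regular_open_rho by auto
  \<comment> \<open>Here the transfer lemma runs from \<open>?N\<close> to \<open>?M\<close>, with
    \<open>d_op v\<close> in the role of \<open>f\<close> and \<open>rho\<close> as its left
    inverse; tidiness is witnessed by \<open>V\<close> itself for each
    \<open>d_op v V\<close>.\<close>
  have i: "maximal_generic_subalgebra (d_op v ` \<BB>) ?M \<and> tidy (d_op v ` \<BB>) \<and>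
      iso_via v (d_op v ` \<BB>) \<BB>" if \<BB>: "maximal_generic_subalgebra \<BB> ?N" for \<BB>
  proof -
    have sub: "\<BB> \<subseteq> \<AA>"
      using \<BB> by (simp add: maximal_generic_subalgebra_def generic_subalgebra_def g_subalgebra_def)
    have inv: "rho (d_op v V) = V" if "V \<in> \<BB>" for V using that sub RO rho_d by blast
    have "maximal_generic_subalgebra (d_op v ` \<BB>) ?M"
      using maximal_generic_subalgebra_transfer[OF N M nontriv(2) d[OF v] rho \<BB> inv] .
    moreover have "tidy (d_op v ` \<BB>)"
      using d_op_frakU[OF assms(5)] sub RO by (fastforce simp: tidy_def tidy_set_def)
    moreover have "iso_via v (d_op v ` \<BB>) \<BB>"
      using g_iso_of_inverse_homs[OF d[OF v] rho _ inv, of \<BB>] sub inv by (simp add: iso_via_def)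
    ultimately show ?thesis by blast
  qed
  \<comment> \<open>The same transfer in the opposite direction: \<open>rho\<close> is now
    \<open>f\<close>, and \<open>d_op u\<close> is its left inverse on \<open>\<B>\<close>.\<close>
  have ii: "maximal_generic_subalgebra (rho ` \<B>) ?N \<and> iso_via u \<B> (rho ` \<B>)"
    if \<B>: "maximal_generic_subalgebra \<B> ?M" and u: "ultrafilter u ?R"
      and mem: "\<And>B. B \<in> \<B> \<Longrightarrow> 0 \<in> B \<Longrightarrow> rho B \<in> u" for \<B> u
  proof -
    have inv: "d_op u (rho B) = B" if "B \<in> \<B>" for B
      using d_op_rho_eqI[OF sub_M(2,3)[OF \<B>] u mem that] .
    show ?thesis
      using maximal_generic_subalgebra_transfer[OF M N nontriv(1) rho d[OF u] \<B> inv]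
        g_iso_of_inverse_homs[OF rho d[OF u] _ inv, of \<B>] sub_M(1)[OF \<B>] inv
      by (simp add: iso_via_def)
  qed
  \<comment> \<open>The family \<open>\<V>\<close> is a parameter so that one construction serves
    twice: with all regular open neighbourhoods of \<open>0\<close> it puts \<open>u\<close> into
    \<open>frakU\<close>, and with \<open>{UNIV}\<close> it adds no constraint.\<close>
  have ex_u: "\<exists>u. ultrafilter u ?R \<and> \<V> \<subseteq> u \<and> (\<forall>B\<in>\<B>. 0 \<in> B \<longrightarrow> rho B \<in> u)"
    if \<B>: "maximal_generic_subalgebra \<B> ?M"
      and \<V>: "UNIV \<in> \<V>" "\<And>V. V \<in> \<V> \<Longrightarrow> regular_open V"
        "\<And>V W. V \<in> \<V> \<Longrightarrow> W \<in> \<V> \<Longrightarrow> V \<inter> W \<in> \<V>"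
        "\<And>V B. V \<in> \<V> \<Longrightarrow> B \<in> \<B> \<Longrightarrow> 0 \<in> B \<Longrightarrow> rho B \<inter> V \<noteq> {}" for \<B> \<V>
  proof -
    define F where "F = {rho B \<inter> V | B V. B \<in> \<B> \<and> 0 \<in> B \<and> V \<in> \<V>}"
    have UNIV_mem: "UNIV \<in> \<B>" and Int_mem: "\<And>B C. B \<in> \<B> \<Longrightarrow> C \<in> \<B> \<Longrightarrow> B \<inter> C \<in> \<B>"
      using sub_M(2)[OF \<B>] by (auto simp: g_subalgebra_def powerset_alg_def)
    have rho_UNIV: "rho (UNIV :: 'a set) = UNIV" by (simp add: rho_def)
    have rho_meet: "rho (B \<inter> C) = rho B \<inter> rho C" if "B \<in> \<B>" "C \<in> \<B>" for B C
    proof -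
      have "B \<in> \<A>" "C \<in> \<A>" using sub_M(1)[OF \<B>] that by auto
      then show ?thesis using rho by (simp add: g_hom_def powerset_alg_def RO_alg_def)
    qed
    have F_mem: "rho B \<inter> V \<in> F" if "B \<in> \<B>" "0 \<in> B" "V \<in> \<V>" for B V
      unfolding F_def using that by blast
    have B_mem: "rho B \<in> F" if "B \<in> \<B>" "0 \<in> B" for B
      using F_mem[OF that \<V>(1)] by simp
    have V_mem: "\<V> \<subseteq> F"
      using F_mem[OF UNIV_mem UNIV_I] by (auto simp: rho_UNIV)
    then have "F \<noteq> {}" using \<V>(1) by auto
    moreover have "{} \<notin> F"
    proof
      assume "{} \<in> F"
      then obtain B V where "B \<in> \<B>" "0 \<in> B" "V \<in> \<V>" "rho B \<inter> V = {}" unfolding F_def by auto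
      then show False using \<V>(4)[of V B] by simp
    qed
    moreover have "regular_open a" if a: "a \<in> F" for a
    proof -
      obtain B V where "a = rho B \<inter> V" "V \<in> \<V>" using a unfolding F_def by blast
      then show ?thesis using \<V>(2)[of V] by (simp add: regular_open_Int regular_open_rho)
    qed
    moreover have "a \<inter> b \<in> F" if ab: "a \<in> F" "b \<in> F" for a b
    proof -
      obtain B V where a: "a = rho B \<inter> V" "B \<in> \<B>" "0 \<in> B" "V \<in> \<V>"
        using ab(1) unfolding F_def by blast
      obtain C W where b: "b = rho C \<inter> W" "C \<in> \<B>" "0 \<in> C" "W \<in> \<V>"
        using ab(2) unfolding F_def by blast
      \<comment> \<open>The sets \<open>rho B\<close> with \<open>0\<close> in \<open>B\<close> are
        closed under intersection because \<open>rho\<close> preserves meets on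
        \<open>\<B>\<close>.\<close>
      have "a \<inter> b = rho (B \<inter> C) \<inter> (V \<inter> W)" using a b by (auto simp: rho_meet)
      then show ?thesis using F_mem[OF Int_mem[OF a(2) b(2)] _ \<V>(3)[OF a(4) b(4)]] a(3) b(3) by simp
    qed
    ultimately obtain u where u: "ultrafilter u ?R" "F \<subseteq> u"
      by (rule ex_RO_ultrafilter)
    then show ?thesis using B_mem V_mem by (intro exI[of _ u] conjI) auto
  qed
  have "\<exists>u\<in>frakU. \<exists>\<BB>. maximal_generic_subalgebra \<BB> ?N \<and> iso_via u \<B> \<BB>"
    if \<B>: "maximal_generic_subalgebra \<B> ?M" "tidy \<B>" for \<B>
  proof -
    define N0 where "N0 = {V :: 'a set. regular_open V \<and> 0 \<in> V}"
    \<comment> \<open>Tidiness puts \<open>0\<close> into the closure of a regular open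
      \<open>W\<close> that equals \<open>rho B\<close>, so every neighbourhood of \<open>0\<close>
      meets \<open>rho B\<close>.\<close>
    have meets: "rho B \<inter> V \<noteq> {}" if V: "V \<in> N0" "B \<in> \<B>" "0 \<in> B" for V B
    proof -
      obtain W where W: "regular_open W" "W \<subseteq> B" "B \<subseteq> closure W"
        using V(2) \<B>(2) by (auto simp: tidy_def tidy_set_def)
      then have "0 \<in> V \<inter> closure W" using V by (auto simp: N0_def)
      then have "V \<inter> W \<noteq> {}"
        using V(1) open_Int_closure_eq_empty[OF open_regular_open, of V W] by (auto simp: N0_def)
      then show ?thesis using rho_eq_of_between[OF W] by auto
    qed
    have "\<exists>u. ultrafilter u ?R \<and> N0 \<subseteq> u \<and> (\<forall>B\<in>\<B>. 0 \<in> B \<longrightarrow> rho B \<in> u)"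
    proof (rule ex_u[OF \<B>(1) _ _ _ meets])
      show "UNIV \<in> N0" by (simp add: N0_def regular_open_def)
      show "V \<inter> W \<in> N0" if "V \<in> N0" "W \<in> N0" for V W
        using that by (simp add: N0_def regular_open_Int)
    qed (simp add: N0_def)
    then obtain u where "ultrafilter u ?R \<and> N0 \<subseteq> u \<and> (\<forall>B\<in>\<B>. 0 \<in> B \<longrightarrow> rho B \<in> u)" ..
    then have u: "ultrafilter u ?R" "N0 \<subseteq> u" "\<forall>B\<in>\<B>. 0 \<in> B \<longrightarrow> rho B \<in> u"
      by simp_all
    then have "u \<in> frakU" by (auto simp: frakU_def N0_def)
    moreover have "maximal_generic_subalgebra (rho ` \<B>) ?N \<and> iso_via u \<B> (rho ` \<B>)"
      by (rule ii[OF \<B>(1) u(1)]) (simp add: u(3))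
    ultimately show ?thesis by blast
  qed
  moreover have "\<exists>\<BB> \<B> \<phi>. maximal_generic_subalgebra \<BB> ?N \<and> maximal_generic_subalgebra \<B> ?M \<and>
      tidy \<B> \<and> \<phi> \<in> g_iso (?P\<lparr>carr := \<B>\<^sub>0\<rparr>) (?P\<lparr>carr := \<B>\<rparr>) \<and> iso_via v \<B> \<BB> \<and>
      (\<forall>B\<in>\<B>\<^sub>0. nowhere_dense (sym_diff (\<phi> B) B))"
    if \<B>\<^sub>0: "maximal_generic_subalgebra \<B>\<^sub>0 ?M" for \<B>\<^sub>0
  proof -
    \<comment> \<open>Without tidiness \<open>0\<close> may lie outside the closure of
      \<open>rho B\<close>, but genericity makes \<open>rho\<close> injective on
      \<open>\<B>\<^sub>0\<close>, so only the empty set has empty image.\<close>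
    have nonempty: "rho B \<noteq> {}" if "B \<in> \<B>\<^sub>0" "0 \<in> B" for B
    proof
      assume "rho B = {}"
      moreover have "rho {} = ({} :: 'a set)" by (simp add: rho_def)
      moreover have "{} \<in> \<B>\<^sub>0"
        using sub_M(2)[OF \<B>\<^sub>0] by (auto simp: g_subalgebra_def powerset_alg_def)
      ultimately have "B = {}" using sub_M(4)[OF \<B>\<^sub>0] that(1) by (auto dest: inj_onD)
      then show False using that(2) by simp
    qed
    have "\<exists>u. ultrafilter u ?R \<and> {UNIV} \<subseteq> u \<and> (\<forall>B\<in>\<B>\<^sub>0. 0 \<in> B \<longrightarrow> rho B \<in> u)"
      by (rule ex_u[OF \<B>\<^sub>0]) (use nonempty in \<open>auto simp: regular_open_def\<close>)
    then obtain u where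
      "ultrafilter u ?R \<and> {UNIV} \<subseteq> u \<and> (\<forall>B\<in>\<B>\<^sub>0. 0 \<in> B \<longrightarrow> rho B \<in> u)" ..
    then have u: "ultrafilter u ?R" "\<forall>B\<in>\<B>\<^sub>0. 0 \<in> B \<longrightarrow> rho B \<in> u"
      by simp_all
    let ?B = "rho ` \<B>\<^sub>0"
    have "maximal_generic_subalgebra ?B ?N \<and> iso_via u \<B>\<^sub>0 ?B"
      by (rule ii[OF \<B>\<^sub>0 u(1)]) (simp add: u(2))
    then have max: "maximal_generic_subalgebra ?B ?N" and iso: "iso_via u \<B>\<^sub>0 ?B"
      by auto
    \<comment> \<open>The auxiliary \<open>u\<close> only serves to show that \<open>rho\<close> is
      an isomorphism onto a maximal generic subalgebra; the way back is taken with the given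
      \<open>v\<close>, which makes the result tidy by \<open>i\<close>.\<close>
    have "d_op v \<circ> rho \<in> g_iso (?P\<lparr>carr := \<B>\<^sub>0\<rparr>) (?P\<lparr>carr := d_op v ` ?B\<rparr>)"
      using iso i[OF max] by (auto simp: iso_via_def intro: g_iso_comp)
    moreover have "nowhere_dense (sym_diff ((d_op v \<circ> rho) B) B)" if "B \<in> \<B>\<^sub>0" for B
    proof -
      let ?C = "d_op v (rho B)"
      have B: "B \<in> \<A>" using that sub_M(1)[OF \<B>\<^sub>0] by auto
      have C: "?C \<in> \<A>" using d_op_rho_mem[OF assms(1-3) v B] .
      have rho_C: "rho ?C = rho B" by (rule rho_d[OF regular_open_rho])
      have \<A>_mem: "- X \<in> \<A>" "X \<inter> Y \<in> \<A>" if "X \<in> \<A>" "Y \<in> \<A>" for X Y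
        using assms(1) that by (auto simp: g_subalgebra_def powerset_alg_def)
      \<comment> \<open>Since \<open>?C\<close> and \<open>B\<close> have the same image under
        \<open>rho\<close>, each difference is sent to the meet of an element with its complement,
        and the symmetric difference to the join of two bottoms.\<close>
      have diff: "rho (X \<inter> - Y) = {}" if "X \<in> \<A>" "Y \<in> \<A>" "rho X = rho Y" for X Y
      proof -
        have "rho (X \<inter> - Y) = rho Y \<inter> interior (- rho Y)"
          using rho_hom[OF \<A>] that \<A>_mem by (simp add: g_hom_def RO_alg_def powerset_alg_def)
        then show ?thesis using interior_subset[of "- rho Y"] by auto
      qed
      have "rho (?C \<inter> - B \<union> B \<inter> - ?C) =
          interior (closure (rho (?C \<inter> - B) \<union> rho (B \<inter> - ?C)))"
        using rho_hom[OF \<A>] B C \<A>_mem by (simp add: g_hom_def RO_alg_def powerset_alg_def)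
      also have "\<dots> = {}" using diff[OF C B rho_C] diff[OF B C rho_C[symmetric]] by simp
      finally show ?thesis by (simp add: nowhere_dense_def rho_def Diff_eq)
    qed
    ultimately show ?thesis using max i[OF max] by blast
  qed
  ultimately show ?thesis using i by blast
qed

end
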